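(* Let $A=\mathbb{F}_q[t]$, where $q$ is a power of a prime $p$, let $d>1$ be an integer and let $c\in\mathbb{F}_q^*$. The monic irreducible polynomials of degree $d$ dividing $L_{d-1}-c$ are the same as those dividing $D_{d-1}+(-1)^dc$, and they are exactly the monic irreducible $\wp\in A$ of degree $d$ with $d\wp/dt=(-1)^{d-1}c$, i.e. the monic irreducible $\wp$ of the form $\wp=a^p+(-1)^{d-1}ct$ for some $a\in A$. Such primes exist only when $p$ divides $d$. When they exist, each divides $L_{d-1}-c$ with multiplicity at least $p-1$, and divides $D_{d-1}+(-1)^dc$ with multiplicity one.
   Context: For $n\ge 0$, $[n]:=t^{q^n}-t$. Set $L_0=D_0=1$ and, for $n\ge1$, $L_n=[n]L_{n-1}$ and $D_n=[n]D_{n-1}^q$. *)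

theory Defs
  imports "HOL-Computational_Algebra.Computational_Algebra"
begin

definition bracket :: "nat \<Rightarrow> nat \<Rightarrow> 'a::comm_ring_1 poly" where
  "bracket q n = monom 1 (q ^ n) - monom 1 1"

primrec carlitz_L :: "nat \<Rightarrow> nat \<Rightarrow> 'a::comm_ring_1 poly" where
  "carlitz_L q 0 = 1"
| "carlitz_L q (Suc n) = bracket q (Suc n) * carlitz_L q n"

primrec carlitz_D :: "nat \<Rightarrow> nat \<Rightarrow> 'a::comm_ring_1 poly" where
  "carlitz_D q 0 = 1"
| "carlitz_D q (Suc n) = bracket q (Suc n) * carlitz_D q n ^ q"

definition monic_primes :: "nat \<Rightarrow> 'a::field poly set" where
  "monic_primes d = {P. lead_coeff P = 1 \<and> irreducible P \<and> degree P = d}"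

(* Same formula as the library constant multiplicity. That constant lives in class
   factorial_semiring, of which 'a poly is an instance only if 'a is in factorial_ring_gcd
   and semiring_gcd_mult_normalize, as a type of class field need not be; this version is available over every field. *)
definition poly_multiplicity :: "'a::field poly \<Rightarrow> 'a poly \<Rightarrow> nat" where
  "poly_multiplicity P F = (if finite {n. P ^ n dvd F} then Max {n. P ^ n dvd F} else 0)"

end

theory Submission
  imports Defs "HOL-Number_Theory.Cong"
begin

text \<open>
  Write \<open>t\<close> for the variable and \<open>[n]\<close> for \<open>bracket q n\<close>. Modulo \<open>P ^ q\<close>, the \<open>d\<close> elements
  \<open>t ^ (q ^ (d + i))\<close> with \<open>i < d\<close> are roots of \<open>P\<close> whose pairwise differences are prime to \<open>P\<close>,
  so \<open>P\<close> is the product of the \<open>t - t ^ (q ^ (d + i))\<close>, that is, \<open>P = (-1) ^ d * [d] * L\<close> modulo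
  \<open>P ^ q\<close>, where \<open>L\<close> is \<open>carlitz_L q (d - 1)\<close>. With \<open>[d] = P * Q\<close> this becomes
  \<open>1 = (-1) ^ d * Q * L\<close> modulo \<open>P ^ (q - 1)\<close>, and everything about \<open>L\<close> follows by inverting \<open>Q\<close>.
  Differentiating \<open>[d] = P * Q\<close> gives \<open>P' * Q = -1\<close> modulo \<open>P\<close>; if moreover
  \<open>P = a ^ p + s * t\<close>, then \<open>s * [d] = P ^ (q ^ d) - P - (a ^ (q ^ d) - a) ^ p\<close> gives \<open>s * Q = -1\<close>
  even modulo \<open>P ^ (p - 1)\<close>. Finally, for \<open>D = carlitz_D q (d - 1)\<close>,
  \<open>D ^ q = (-1) ^ (d - 1) * L\<close> modulo \<open>P\<close>, and the derivative of \<open>D\<close> is \<open>- carlitz_D q (d - 2) ^ q\<close>, which is prime to \<open>P\<close>.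
\<close>

section \<open>Roots of a monic polynomial modulo a modulus that need not be prime\<close>

lemma dvd_prod_diff_cancel:
  fixes M :: "'b::comm_ring_1"
  assumes "finite R" and "\<forall>y\<in>R. \<forall>z. M dvd (x - y) * z \<longrightarrow> M dvd z"
    and "M dvd (\<Prod>y\<in>R. x - y) * z"
  shows "M dvd z"
  using assms
proof (induction R arbitrary: z rule: finite_induct)
  case (insert y R)
  have "M dvd (x - y) * ((\<Prod>y\<in>R. x - y) * z)"
    using insert.prems(2) insert.hyps by (simp add: mult.assoc)
  then have "M dvd (\<Prod>y\<in>R. x - y) * z" using insert.prems(1) by blast
  then show ?case using insert.IH insert.prems(1) by blast
qed simp

text \<open>Differences of the listed roots can be cancelled modulo \<open>M\<close>, so a further
  root of \<open>F\<close> is also a root of the cofactor \<open>h\<close> modulo \<open>M\<close>,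
  even when \<open>M\<close> is a prime power. The remainders of the successive divisions are
  collected in \<open>g\<close>.\<close>

lemma monic_roots_mod_factor:
  fixes F :: "'b::idom poly"
  assumes "finite R" and "lead_coeff F = 1" and "\<not> M dvd 1"
    and "\<forall>x\<in>R. M dvd poly F x"
    and "\<forall>x\<in>R. \<forall>y\<in>R. x \<noteq> y \<longrightarrow> (\<forall>z. M dvd (x - y) * z \<longrightarrow> M dvd z)"
  shows "\<exists>h g. F = (\<Prod>x\<in>R. [:- x, 1:]) * h + smult M g \<and> lead_coeff h = 1
           \<and> degree h + card R = degree F"
  using assms(1,4,5)
proof (induction R rule: finite_induct)
  case empty
  show ?case by (rule exI[of _ F], rule exI[of _ 0]) (simp add: assms(2))
next
  case (insert x R)
  have "\<forall>x\<in>R. M dvd poly F x" using insert.prems(1) by blast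
  moreover have "\<forall>x\<in>R. \<forall>y\<in>R. x \<noteq> y \<longrightarrow> (\<forall>z. M dvd (x - y) * z \<longrightarrow> M dvd z)"
    using insert.prems(2) by blast
  ultimately obtain h g where F: "F = (\<Prod>x\<in>R. [:- x, 1:]) * h + smult M g"
    and h: "lead_coeff h = 1" and deg: "degree h + card R = degree F"
    using insert.IH by blast
  have "poly F x = (\<Prod>y\<in>R. x - y) * poly h x + M * poly g x"
    by (simp add: F poly_prod)
  moreover have "M dvd poly F x" using insert.prems by simp
  ultimately have "M dvd (\<Prod>y\<in>R. x - y) * poly h x"
    by (metis dvd_add_left_iff dvd_triv_left)
  moreover have "\<forall>y\<in>R. \<forall>z. M dvd (x - y) * z \<longrightarrow> M dvd z"
  proof
    fix y assume "y \<in> R"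
    then have "x \<noteq> y" using insert.hyps(2) by blast
    then show "\<forall>z. M dvd (x - y) * z \<longrightarrow> M dvd z"
      using insert.prems(2) \<open>y \<in> R\<close> by blast
  qed
  ultimately have root: "M dvd poly h x"
    using dvd_prod_diff_cancel[OF insert.hyps(1)] by blast
  \<comment> \<open>A monic constant is 1, and a root of it would force
    \<open>M dvd 1\<close>.\<close>
  have "degree h \<noteq> 0"
  proof
    assume "degree h = 0"
    then have "poly h x = 1" using h by (auto elim: degree_eq_zeroE)
    then show False using root assms(3) by simp
  qed
  define k where "k = synthetic_div h x"
  have hk: "h = [:- x, 1:] * k + [:poly h x:]" by (simp only: k_def synthetic_div_correct')
  have degk: "degree h = Suc (degree k)" using \<open>degree h \<noteq> 0\<close> by (simp add: k_def degree_synthetic_div)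
  have "coeff h (Suc (degree k)) = coeff k (degree k)"
    by (subst hk) (simp add: coeff_eq_0)
  then have k: "lead_coeff k = 1" using h degk by simp
  obtain r where r: "poly h x = M * r" using root by (rule dvdE)
  have "F = (\<Prod>x\<in>insert x R. [:- x, 1:]) * k + smult M (g + smult r (\<Prod>x\<in>R. [:- x, 1:]))"
  proof -
    have "F = (\<Prod>x\<in>R. [:- x, 1:]) * ([:- x, 1:] * k + [:M * r:]) + smult M g"
      using F hk r by simp
    then show ?thesis using insert.hyps by (simp add: algebra_simps smult_add_right)
  qed
  moreover have "degree k + card (insert x R) = degree F"
    using deg degk insert.hyps by simp
  ultimately show ?case using k by blast
qed

lemma monic_roots_mod_card_le:
  fixes F :: "'b::idom poly"
  assumes "finite R" and "lead_coeff F = 1" and "\<not> M dvd 1"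
    and "\<forall>x\<in>R. M dvd poly F x"
    and "\<forall>x\<in>R. \<forall>y\<in>R. x \<noteq> y \<longrightarrow> (\<forall>z. M dvd (x - y) * z \<longrightarrow> M dvd z)"
  shows "card R \<le> degree F"
  using monic_roots_mod_factor[OF assms] by auto

lemma monic_roots_mod_poly:
  fixes F :: "'b::idom poly"
  assumes "finite R" and "lead_coeff F = 1" and "\<not> M dvd 1"
    and "\<forall>x\<in>R. M dvd poly F x"
    and "\<forall>x\<in>R. \<forall>y\<in>R. x \<noteq> y \<longrightarrow> (\<forall>z. M dvd (x - y) * z \<longrightarrow> M dvd z)"
    and "card R = degree F"
  shows "M dvd poly F y - (\<Prod>x\<in>R. y - x)"
proof -
  obtain h g where F: "F = (\<Prod>x\<in>R. [:- x, 1:]) * h + smult M g"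
    and h: "lead_coeff h = 1" and "degree h + card R = degree F"
    using monic_roots_mod_factor[OF assms(1-5)] by blast
  then have "degree h = 0" using assms(6) by simp
  then have "h = 1" using h by (metis degree_0_id one_pCons)
  then show ?thesis by (simp add: F poly_prod)
qed

section \<open>Counting over a finite field\<close>

text \<open>The condition on coefficients means degree below \<open>d\<close>, with the zero
  polynomial included. These polynomials later represent the residues modulo a prime of degree
  \<open>d\<close>.\<close>

lemma card_coeff_eq_0:
  "finite {f :: 'a::{zero,finite} poly. \<forall>n\<ge>d. coeff f n = 0}
   \<and> card {f :: 'a poly. \<forall>n\<ge>d. coeff f n = 0} = card (UNIV :: 'a set) ^ d"
proof (induction d)
  case 0
  have "{f :: 'a poly. \<forall>n\<ge>0. coeff f n = 0} = {0}" by (auto simp: poly_eq_iff)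
  then show ?case by simp
next
  case (Suc d)
  let ?S = "\<lambda>d. {f :: 'a poly. \<forall>n\<ge>d. coeff f n = 0}"
  have "?S (Suc d) = (\<lambda>(a, f). pCons a f) ` (UNIV \<times> ?S d)"
  proof (intro equalityI subsetI)
    fix f assume "f \<in> ?S (Suc d)"
    moreover obtain a g where "f = pCons a g" by (rule pCons_cases)
    ultimately show "f \<in> (\<lambda>(a, f). pCons a f) ` (UNIV \<times> ?S d)"
      by (force simp: coeff_pCons split: nat.splits)
  qed (auto simp: coeff_pCons split: nat.splits)
  moreover have "inj_on (\<lambda>(a, f). pCons a f) (UNIV \<times> ?S d)" by (auto simp: inj_on_def)
  ultimately show ?case using Suc by (simp add: card_image card_cartesian_product)
qed

text \<open>Multiplication by a nonzero \<open>x\<close> permutes the nonzero elements, whose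
  product can be cancelled.\<close>

lemma finite_field_power_card:
  fixes x :: "'a::{field,finite}"
  shows "x ^ card (UNIV :: 'a set) = x"
proof (cases "x = 0")
  case False
  have pos: "card (UNIV :: 'a set) > 0" by (simp add: card_gt_0_iff)
  have "(\<Prod>y\<in>UNIV-{0}. x * y) = (\<Prod>y\<in>UNIV-{0}. y)"
    by (rule prod.reindex_bij_witness[of _ "\<lambda>y. y / x" "\<lambda>y. x * y"]) (use False in auto)
  then have "x ^ (card (UNIV :: 'a set) - 1) = 1" by (simp add: prod.distrib)
  then have "x ^ Suc (card (UNIV :: 'a set) - 1) = x" by simp
  then show ?thesis using pos by simp
qed (simp add: card_gt_0_iff)

lemma prime_elem_dvd_prodD:
  assumes "prime_elem x" and "x dvd prod f A"
  shows "\<exists>a\<in>A. x dvd f a"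
  using assms(2)
proof (induction A rule: infinite_finite_induct)
  case (insert a A)
  then show ?case using assms(1) by (auto simp: prime_elem_dvd_mult_iff)
qed (use prime_elem_not_unit[OF assms(1)] in auto)

section \<open>Multiplicity of a factor\<close>

text \<open>For nonzero \<open>F\<close> the degree bounds the exponents, so the default value 0 of
  \<open>poly_multiplicity\<close> does not arise.\<close>

lemma poly_multiplicity_ge:
  assumes "irreducible P" and "F \<noteq> 0" and "P ^ m dvd F"
  shows "m \<le> poly_multiplicity P F"
proof -
  have "degree P \<noteq> 0"
    using assms(1) by (metis irreducible_def is_unit_iff_degree)
  have "n \<le> degree F" if "P ^ n dvd F" for n
  proof -
    have "n \<le> degree (P ^ n)"
      using \<open>degree P \<noteq> 0\<close> assms(1) by (simp add: degree_power_eq irreducible_def)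
    also have "\<dots> \<le> degree F" using that assms(2) by (rule dvd_imp_degree_le)
    finally show ?thesis .
  qed
  then have "finite {n. P ^ n dvd F}"
    by (metis (mono_tags, lifting) finite_nat_set_iff_bounded_le mem_Collect_eq)
  then show ?thesis using assms(3) by (simp add: poly_multiplicity_def)
qed

text \<open>A factor \<open>P * P\<close> of \<open>F\<close> would leave a factor \<open>P\<close>
  in the derivative.\<close>

lemma poly_multiplicity_eq_1:
  assumes "P dvd F" and "\<not> P dvd pderiv F"
  shows "poly_multiplicity P F = 1"
proof -
  have "\<not> P ^ n dvd F" if "n \<ge> 2" for n
  proof
    assume "P ^ n dvd F"
    then have "P * P dvd F" using that by (metis power_le_dvd power2_eq_square)
    then obtain k where "F = P * (P * k)" by (metis dvdE mult.assoc)
    then have "pderiv F = P * pderiv (P * k) + P * k * pderiv P" by (simp only: pderiv_mult)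
    then show False using assms(2) by (simp add: mult.assoc)
  qed
  moreover have "P ^ n dvd F" if "n < 2" for n
    using that assms(1) by (auto simp: less_2_cases_iff)
  ultimately have "{n. P ^ n dvd F} = {0, 1}" by (auto simp: less_2_cases_iff not_less[symmetric])
  then show ?thesis by (simp add: poly_multiplicity_def)
qed

section \<open>Signs and brackets\<close>

lemma const_sign_mult: "[:(-1) ^ n * c:] = (-1) ^ n * [:c::'a::comm_ring_1:]"
  by (cases "even n") simp_all

lemma sign_mult_sign: "(-1) ^ n * ((-1) ^ n * x) = (x :: 'a::comm_ring_1)"
  by (simp flip: mult.assoc power_mult_distrib)

lemma dvd_sign_mult_iff: "x dvd (-1) ^ n * y \<longleftrightarrow> x dvd (y :: 'a::comm_ring_1)"
  by (metis dvd_mult sign_mult_sign)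

lemma carlitz_L_prod: "carlitz_L q n = (\<Prod>i<n. bracket q (Suc i))"
  by (induction n) (simp_all add: mult.commute)

lemma lead_coeff_bracket:
  assumes "q > 1" and "n > 0"
  shows "degree (bracket q n :: 'a::comm_ring_1 poly) = q ^ n"
    and "lead_coeff (bracket q n :: 'a::comm_ring_1 poly) = 1"
proof -
  have *: "q ^ n > 1" using assms by (rule one_less_power)
  then have "degree (- monom (1::'a) 1) < degree (monom (1::'a) (q ^ n))"
    by (simp add: degree_monom_eq)
  then show d: "degree (bracket q n :: 'a poly) = q ^ n"
    by (metis (no_types) bracket_def degree_add_eq_left degree_monom_eq diff_conv_add_uminus one_neq_zero)
  show "lead_coeff (bracket q n :: 'a poly) = 1"
    unfolding d using * by (simp add: bracket_def)
qed

section \<open>Polynomials over a finite field\<close>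

locale finite_field_polys =
  fixes p e q :: nat and K :: "'a::{field,finite} itself"
  assumes prime_p: "prime p" and e_pos: "e \<ge> 1" and q_eq: "q = p ^ e"
    and card_field: "card (UNIV :: 'a set) = q"
begin

abbreviation X :: "nat \<Rightarrow> 'a poly" where "X n \<equiv> monom 1 (q ^ n)"

text \<open>Translation by 1 permutes the field, so summing \<open>x + 1\<close> over it shows that
  the number \<open>p ^ e\<close> of elements vanishes in the field.\<close>

lemma CHAR_eq: "CHAR('a) = p"
proof -
  have "prime CHAR('a)" by (simp add: finite_imp_CHAR_pos prime_CHAR_semidom)
  moreover have "(\<Sum>x\<in>UNIV. x + 1) = (\<Sum>x\<in>UNIV. x :: 'a)"
    by (rule sum.reindex_bij_witness[of _ "\<lambda>x. x - 1" "\<lambda>x. x + 1"]) auto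
  then have "of_nat (p ^ e) = (0::'a)" by (simp add: sum.distrib card_field q_eq del: of_nat_power)
  then have "CHAR('a) dvd p ^ e" by (simp only: of_nat_eq_0_iff_char_dvd)
  ultimately show ?thesis using prime_p by (metis prime_dvd_power primes_dvd_imp_eq)
qed

lemma p_le_q: "p \<le> q"
  using e_pos prime_gt_0_nat[OF prime_p] by (simp add: q_eq self_le_power)

lemma q_gt_1: "q > 1"
  using p_le_q prime_gt_1_nat[OF prime_p] by simp

lemma power_q_add: "(f + g :: 'a poly) ^ (q ^ n) = f ^ (q ^ n) + g ^ (q ^ n)"
  by (rule freshmans_dream'[where n = "e * n"]) (simp_all add: CHAR_eq prime_p q_eq power_mult)

lemma power_q_diff: "(f - g :: 'a poly) ^ (q ^ n) = f ^ (q ^ n) - g ^ (q ^ n)"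
  using power_q_add[of "f - g" g n] by (simp add: eq_diff_eq)

lemma power_p_diff: "(f - g :: 'a poly) ^ p = f ^ p - g ^ p"
proof -
  have "(f - g + g) ^ p = (f - g) ^ p + g ^ p"
    by (rule freshmans_dream) (simp_all add: CHAR_eq prime_p)
  then show ?thesis by simp
qed

lemma const_power_q: "(x::'a) ^ (q ^ n) = x"
proof (induction n)
  case (Suc n)
  have "x ^ q = x" using finite_field_power_card[of x] by (simp only: card_field)
  then show ?case by (simp only: power_Suc power_mult Suc)
qed simp

text \<open>The \<open>q ^ n\<close>-th power map is additive and fixes the coefficients, so it acts
  on \<open>f\<close> only through the variable.\<close>

lemma pcompose_X: "pcompose f (X n) = f ^ (q ^ n)"
proof (induction f)
  case 0
  then show ?case using q_gt_1 by (simp add: power_0_left)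
next
  case (pCons a f)
  have "pCons a f = [:a:] + monom 1 1 * f" by (simp add: monom_altdef)
  then have "pCons a f ^ (q ^ n) = [:a:] ^ (q ^ n) + (monom 1 1 * f) ^ (q ^ n)"
    by (simp only: power_q_add)
  also have "\<dots> = [:a:] + X n * f ^ (q ^ n)"
    by (simp add: power_mult_distrib monom_power poly_const_pow const_power_q)
  finally show ?case using pCons by (simp add: pcompose_pCons)
qed

lemma X_diff: "X (m + n) - X m = bracket q n ^ (q ^ m)"
  by (simp add: bracket_def power_q_diff monom_power power_add mult.commute)

text \<open>The \<open>q\<close>-th power turns \<open>X n - X i\<close> into
  \<open>X (Suc n) - X (Suc i)\<close>, and \<open>bracket q (Suc n)\<close> supplies the missing
  factor for \<open>i = 0\<close>.\<close>

lemma carlitz_D_prod: "(carlitz_D q n :: 'a poly) = (\<Prod>i<n. X n - X i)"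
proof (induction n)
  case (Suc n)
  have "(X n - X i) ^ q = X (Suc n) - X (Suc i)" for i
    using power_q_diff[of "X n" "X i" 1] by (simp add: monom_power mult.commute)
  then show ?case
    by (simp add: Suc bracket_def prod.lessThan_Suc_shift prod_power_distrib del: prod.lessThan_Suc)
qed simp

lemma pderiv_bracket:
  assumes "n > 0"
  shows "pderiv (bracket q n :: 'a poly) = - 1"
proof -
  have "of_nat q = (0::'a)" using e_pos by (simp add: of_nat_eq_0_iff_char_dvd CHAR_eq q_eq)
  then show ?thesis using assms by (simp add: bracket_def pderiv_diff pderiv_monom)
qed

lemma pderiv_power_p: "pderiv (f ^ p :: 'a poly) = 0"
proof -
  have "of_nat p = (0::'a)" using of_nat_CHAR[where 'a = 'a] CHAR_eq by simp
  then show ?thesis by (simp add: pderiv_power)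
qed

section \<open>Polynomials with constant derivative\<close>

text \<open>Only exponents divisible by \<open>p\<close> survive, and every coefficient has a
  \<open>p\<close>-th root because a finite field is perfect.\<close>

lemma pderiv_eq_0_imp_power_p:
  fixes f :: "'a poly"
  assumes "pderiv f = 0"
  shows "\<exists>a. f = a ^ p"
proof -
  have p: "p > 0" using prime_gt_0_nat[OF prime_p] .
  have coeff_0: "coeff f n = 0" if "\<not> p dvd n" for n
  proof -
    have "n \<noteq> 0" using that by (metis dvd_0_right)
    then obtain m where m: "n = Suc m" using not0_implies_Suc by blast
    have "of_nat n * coeff f n = 0" using assms coeff_pderiv[of f m] by (simp add: m)
    moreover have "of_nat n \<noteq> (0::'a)" using that by (simp add: of_nat_eq_0_iff_char_dvd CHAR_eq)
    ultimately show ?thesis by simp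
  qed
  have root: "(x ^ (p ^ (e - 1))) ^ p = x" for x :: 'a
    using const_power_q[of x 1] e_pos
    by (simp add: q_eq power_mult[symmetric] flip: power_Suc2)
  \<comment> \<open>The range is generous: a nonzero coefficient at \<open>k * p\<close> forces
    \<open>k\<close> to be at most \<open>degree f\<close>, and the surplus terms are 0.\<close>
  define a where "a = (\<Sum>k\<le>degree f. monom (coeff f (k * p) ^ (p ^ (e - 1))) k)"
  have "a ^ p = (\<Sum>k\<le>degree f. monom (coeff f (k * p) ^ (p ^ (e - 1))) k ^ p)"
    unfolding a_def by (rule freshmans_dream_sum) (simp_all add: CHAR_eq prime_p)
  then have ap: "a ^ p = (\<Sum>k\<le>degree f. monom (coeff f (k * p)) (k * p))"
    by (simp add: monom_power root mult.commute del: One_nat_def)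
  have "coeff f n = coeff (a ^ p) n" for n
  proof (cases "p dvd n \<and> n \<le> degree f")
    case True
    then obtain k where k: "n = k * p" by (metis dvd_def mult.commute)
    then have "k \<le> degree f" using True p by (auto intro: order_trans[of k "k * p"])
    then have "coeff (a ^ p) n = (\<Sum>j\<in>{k}. coeff (monom (coeff f (j * p)) (j * p)) n)"
      unfolding ap coeff_sum using p by (intro sum.mono_neutral_right) (auto simp: k)
    then show ?thesis by (simp add: k)
  next
    case False
    then have "coeff f n = 0" using coeff_0 by (auto simp: coeff_eq_0)
    moreover have "coeff (monom (coeff f (k * p)) (k * p)) n = 0" for k
      using calculation by auto
    ultimately show ?thesis by (simp add: ap coeff_sum)
  qed
  then show ?thesis by (metis poly_eqI)
qed

lemma pderiv_eq_const_iff: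
  "pderiv f = [:s::'a:] \<longleftrightarrow> (\<exists>a. f = a ^ p + monom s 1)"
proof
  assume "pderiv f = [:s:]"
  then have "pderiv (f - monom s 1) = 0" by (simp add: pderiv_diff pderiv_monom monom_0)
  then obtain a where "f - monom s 1 = a ^ p" using pderiv_eq_0_imp_power_p by blast
  then show "\<exists>a. f = a ^ p + monom s 1" by (metis diff_add_cancel)
next
  assume "\<exists>a. f = a ^ p + monom s 1"
  then show "pderiv f = [:s:]"
    by (auto simp: pderiv_add pderiv_power_p pderiv_monom monom_0)
qed

end

section \<open>Congruences modulo a monic prime\<close>

locale prime_poly = finite_field_polys p e q K
  for p e q :: nat and K :: "'a::{field,finite} itself" +
  fixes P :: "'a poly" and d :: nat
  assumes irreducible_P: "irreducible P" and monic_P: "lead_coeff P = 1"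
    and degree_P: "degree P = d" and d_gt_1: "d > 1"
begin

abbreviation L :: "'a poly" where "L \<equiv> carlitz_L q (d - 1)"
abbreviation D :: "'a poly" where "D \<equiv> carlitz_D q (d - 1)"

lemma prime_P: "prime_elem P"
  using irreducible_P by (rule field_poly_irreducible_imp_prime)

lemma not_dvd_1: "\<not> P dvd 1"
  using prime_P by (rule prime_elem_not_unit)

section \<open>Residues modulo \<open>P\<close> and brackets\<close>

lemma not_dvd_small:
  assumes "f \<noteq> 0" and "\<forall>n\<ge>d. coeff f n = 0"
  shows "\<not> P dvd f"
proof
  assume "P dvd f"
  then have "d \<le> degree f" using assms(1) degree_P by (metis dvd_imp_degree_le)
  then show False using assms by (metis leading_coeff_0_iff)
qed

text \<open>Multiplication by \<open>f\<close> permutes the \<open>q ^ d - 1\<close> nonzero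
  residues, represented by the nonzero polynomials of degree below \<open>d\<close>; their product
  is prime to \<open>P\<close> and cancels.\<close>

lemma fermat:
  assumes "\<not> P dvd f"
  shows "P dvd f ^ (q ^ d - 1) - 1"
proof -
  define S where "S = {g :: 'a poly. \<forall>n\<ge>d. coeff g n = 0}"
  have finS: "finite S" and cardS: "card S = q ^ d"
    using card_coeff_eq_0[of d, where 'a = 'a] card_field by (simp_all add: S_def)
  have diff_in: "g - h \<in> S" if "g \<in> S" "h \<in> S" for g h using that by (simp add: S_def)
  have small: "g = 0" if "g \<in> S" "P dvd g" for g
    using that not_dvd_small by (auto simp: S_def)
  have "P \<noteq> 0" using irreducible_P by auto
  have mod_in: "g mod P \<in> S" for g
    using degree_mod_less[OF \<open>P \<noteq> 0\<close>, of g] degree_P by (auto simp: S_def coeff_eq_0)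
  define m where "m = (\<lambda>g. (f * g) mod P)"
  have m_dvd: "P dvd m g - f * g" for g unfolding m_def
    by (metis mod_mod_trivial mod_eq_dvd_iff)
  have "inj_on m (S - {0})"
  proof (rule inj_onI)
    fix g h assume *: "g \<in> S - {0}" "h \<in> S - {0}" "m g = m h"
    then have "P dvd f * (g - h)" by (simp add: m_def mod_eq_dvd_iff right_diff_distrib)
    then have "P dvd g - h" using prime_P assms by (simp add: prime_elem_dvd_mult_iff)
    then show "g = h" using small[OF diff_in] * by simp
  qed
  moreover have "m ` (S - {0}) \<subseteq> S - {0}"
  proof
    fix h assume "h \<in> m ` (S - {0})"
    then obtain g where g: "g \<in> S" "g \<noteq> 0" "h = m g" by auto
    then have "\<not> P dvd f * g" using assms small prime_P by (auto simp: prime_elem_dvd_mult_iff)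
    then have "m g \<noteq> 0" by (simp add: m_def mod_eq_0_iff_dvd)
    then show "h \<in> S - {0}" using g mod_in by (simp add: m_def)
  qed
  ultimately have "bij_betw m (S - {0}) (S - {0})"
    using finS by (simp add: bij_betw_def endo_inj_surj)
  then have "(\<Prod>g\<in>S-{0}. m g) = \<Prod>(S - {0})"
    using prod.reindex_bij_betw[of m "S - {0}" "S - {0}" "\<lambda>g. g"] by simp
  moreover have "[(\<Prod>g\<in>S-{0}. m g) = (\<Prod>g\<in>S-{0}. f * g)] (mod P)"
    by (rule cong_prod) (simp add: m_def cong_def)
  moreover have "card (S - {0}) = q ^ d - 1" using finS cardS by (simp add: S_def)
  ultimately have "[\<Prod>(S - {0}) = f ^ (q ^ d - 1) * \<Prod>(S - {0})] (mod P)"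
    by (simp add: prod.distrib)
  then have "P dvd f ^ (q ^ d - 1) * \<Prod>(S - {0}) - \<Prod>(S - {0})"
    by (metis cong_sym mod_eq_dvd_iff cong_def)
  then have "P dvd (f ^ (q ^ d - 1) - 1) * \<Prod>(S - {0})" by (simp add: left_diff_distrib)
  moreover have "\<not> P dvd \<Prod>(S - {0})"
    using small prime_elem_dvd_prodD[OF prime_P, of "\<lambda>g. g" "S - {0}"] by auto
  ultimately show ?thesis using prime_P by (simp add: prime_elem_dvd_mult_iff)
qed

lemma fermat': "P dvd f ^ (q ^ d) - f"
proof (cases "P dvd f")
  case True
  then show ?thesis using q_gt_1 by (simp add: dvd_power_le dvd_diff dvd_trans[OF True dvd_power])
next
  case False
  have "f ^ (q ^ d) = f * f ^ (q ^ d - 1)"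
    using q_gt_1 by (simp flip: power_Suc)
  then have "f ^ (q ^ d) - f = f * (f ^ (q ^ d - 1) - 1)" by (simp add: right_diff_distrib)
  then show ?thesis using fermat[OF False] by simp
qed

lemma dvd_bracket: "P dvd bracket q d"
  using fermat'[of "monom 1 1"] by (simp add: bracket_def monom_power)

text \<open>If \<open>P\<close> divided \<open>bracket q i\<close>, all \<open>q ^ d\<close> residues modulo \<open>P\<close> would be roots of
  \<open>Y ^ (q ^ i) - Y\<close>.\<close>

lemma not_dvd_bracket:
  assumes "0 < i" and "i < d"
  shows "\<not> P dvd bracket q i"
proof
  assume dvd: "P dvd bracket q i"
  define S where "S = {g :: 'a poly. \<forall>n\<ge>d. coeff g n = 0}"
  have finS: "finite S" and cardS: "card S = q ^ d"
    using card_coeff_eq_0[of d, where 'a = 'a] card_field by (simp_all add: S_def)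
  \<comment> \<open>This is \<open>Y ^ (q ^ i) - Y\<close> in a new variable \<open>Y\<close>, with
    coefficients in \<open>'a poly\<close>.\<close>
  let ?G = "bracket q i :: 'a poly poly"
  have root: "P dvd poly ?G g" for g
  proof -
    \<comment> \<open>The assumption makes \<open>X i\<close> congruent to the variable, so
      substituting either into \<open>g\<close> gives congruent results. By
      \<open>pcompose_X\<close> these are \<open>g ^ (q ^ i)\<close> and \<open>g\<close>.\<close>
    have "P dvd pcompose g (X i) - pcompose g (monom 1 1)"
    proof (induction g)
      case (pCons a g)
      have "pcompose (pCons a g) (X i) - pcompose (pCons a g) (monom 1 1)
          = X i * (pcompose g (X i) - pcompose g (monom 1 1)) + bracket q i * pcompose g (monom 1 1)"
        by (simp add: pcompose_pCons bracket_def algebra_simps)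
      then show ?case using pCons dvd by simp
    qed simp
    then show ?thesis
      using pcompose_X[of g 0] pcompose_X[of g i] by (simp add: bracket_def poly_monom)
  qed
  have "card S \<le> degree ?G"
  proof (rule monic_roots_mod_card_le[OF finS])
    show "lead_coeff ?G = 1"
      using q_gt_1 assms(1) by (rule lead_coeff_bracket)
    show "\<not> P dvd 1" by (rule not_dvd_1)
    show "\<forall>x\<in>S. P dvd poly ?G x" using root by blast
    show "\<forall>x\<in>S. \<forall>y\<in>S. x \<noteq> y \<longrightarrow> (\<forall>z. P dvd (x - y) * z \<longrightarrow> P dvd z)"
    proof (intro ballI impI allI)
      fix x y z assume "x \<in> S" "y \<in> S" "x \<noteq> y" "P dvd (x - y) * z"
      moreover from this have "\<not> P dvd x - y" by (intro not_dvd_small) (auto simp: S_def)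
      ultimately show "P dvd z" using prime_P by (simp add: prime_elem_dvd_mult_iff)
    qed
  qed
  moreover have "degree ?G = q ^ i" using q_gt_1 assms(1) by (rule lead_coeff_bracket)
  moreover have "q ^ i < q ^ d" using q_gt_1 assms by simp
  ultimately show False using cardS by simp
qed

text \<open>Up to sign the difference is a power of a bracket whose index is the distance of
  \<open>m\<close> and \<open>n\<close>. The hypotheses say that this distance lies strictly between
  0 and \<open>d\<close>.\<close>

lemma not_dvd_X_diff:
  assumes "m \<noteq> n" and "m < n + d" and "n < m + d"
  shows "\<not> P dvd X n - X m"
proof -
  have *: "\<not> P dvd X n - X m" if "m < n" "n < m + d" for m n
  proof -
    have "\<not> P dvd bracket q (n - m)" using that by (intro not_dvd_bracket) auto
    then show ?thesis using X_diff[of m "n - m"] that prime_elem_dvd_power[OF prime_P] by auto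
  qed
  show ?thesis
  proof (cases "m < n")
    case False
    then have "n < m" using assms(1) by simp
    then have "\<not> P dvd - (X n - X m)" unfolding minus_diff_eq using assms(2) by (rule *)
    then show ?thesis unfolding dvd_minus_iff .
  qed (use * assms in simp)
qed

text \<open>Modulo \<open>P ^ q\<close>, the polynomial \<open>P\<close> has the \<open>d\<close> roots \<open>X (d + i)\<close> for \<open>i < d\<close>: these
  lift the conjugates of the residue of \<open>t\<close>, and \<open>P\<close> takes the value \<open>P ^ (q ^ (d + i))\<close> there.\<close>

lemma power_q_dvd: "P ^ q dvd P - (-1) ^ d * bracket q d * L"
proof -
  define k where "k = d - 1"
  have d: "d = Suc k" using d_gt_1 by (simp add: k_def)
  have inj: "inj_on (\<lambda>i. X (d + i)) {..<d}"
  proof (intro inj_onI, rule ccontr)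
    fix i j
    assume *: "i \<in> {..<d}" "j \<in> {..<d}" "X (d + i) = X (d + j)" "i \<noteq> j"
    then have "\<not> P dvd X (d + i) - X (d + j)" by (intro not_dvd_X_diff) auto
    then show False using *(3) by simp
  qed
  \<comment> \<open>Shifting the exponent index by \<open>d\<close> keeps the residues modulo
    \<open>P\<close>, since \<open>P\<close> divides \<open>bracket q d\<close>, but makes every
    value of \<open>P\<close> at these points, even for \<open>i = 0\<close>, divisible by
    \<open>P ^ q\<close>.\<close>
  define R where "R = (\<lambda>i. X (d + i)) ` {..<d}"
  \<comment> \<open>The coefficients of \<open>P\<close> become constants of \<open>'a poly\<close>,
    so that \<open>P\<close> can be evaluated at polynomials.\<close>
  define G where "G = map_poly (\<lambda>a. [:a:]) P"
  have poly_G: "poly G g = pcompose P g" for g by (simp add: G_def pcompose_altdef)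
  have deg: "degree G = d" unfolding G_def using degree_P by (subst degree_map_poly) auto
  have "P ^ q dvd poly G (monom 1 1) - (\<Prod>x\<in>R. monom 1 1 - x)"
  proof (rule monic_roots_mod_poly)
    show "finite R" by (simp add: R_def)
    show "lead_coeff G = 1" unfolding deg using monic_P degree_P by (simp add: G_def coeff_map_poly)
    show "\<not> P ^ q dvd 1" using not_dvd_1 q_gt_1 by (metis dvd_power dvd_trans less_imp_le zero_less_one order.strict_trans)
    show "\<forall>x\<in>R. P ^ q dvd poly G x"
    proof
      fix x assume "x \<in> R"
      then obtain i where i: "x = X (d + i)" by (auto simp: R_def)
      have "q \<le> q ^ (d + i)" using q_gt_1 d_gt_1 by (intro self_le_power) auto
      then show "P ^ q dvd poly G x" unfolding poly_G i pcompose_X by (rule le_imp_power_dvd)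
    qed
    show "\<forall>x\<in>R. \<forall>y\<in>R. x \<noteq> y \<longrightarrow> (\<forall>z. P ^ q dvd (x - y) * z \<longrightarrow> P ^ q dvd z)"
    proof (intro ballI impI allI)
      fix x y z assume *: "x \<in> R" "y \<in> R" "x \<noteq> y" "P ^ q dvd (x - y) * z"
      then obtain i j where ij: "i < d" "j < d" "x = X (d + i)" "y = X (d + j)" by (auto simp: R_def)
      then have "\<not> P dvd x - y" using *(3) unfolding ij by (intro not_dvd_X_diff) auto
      then show "P ^ q dvd z" using prime_power_dvd_multD[OF prime_P *(4)] q_gt_1 by simp
    qed
    show "card R = degree G" unfolding R_def deg using inj by (simp add: card_image)
  qed
  then have "P ^ q dvd P - (\<Prod>i<d. monom 1 1 - X (d + i))"
    using pcompose_X[of P 0] by (simp add: poly_G R_def prod.reindex[OF inj])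
  moreover have "[(\<Prod>i<d. monom 1 1 - X (d + i)) = (-1) ^ d * bracket q d * L] (mod P ^ q)"
  proof -
    \<comment> \<open>The two sides differ by a power of \<open>bracket q d\<close> with exponent at
      least \<open>q\<close>.\<close>
    have step: "[monom 1 1 - X (d + Suc i) = - bracket q (Suc i)] (mod P ^ q)" for i
    proof -
      have "monom 1 1 - X (d + Suc i) - (- bracket q (Suc i)) = - (X (Suc i + d) - X (Suc i))"
        by (simp add: bracket_def add.commute)
      then have "monom 1 1 - X (d + Suc i) - (- bracket q (Suc i)) = - (bracket q d ^ (q ^ Suc i))"
        by (simp only: X_diff)
      moreover have "q \<le> q ^ Suc i" using q_gt_1 by (intro self_le_power) auto
      then have "P ^ q dvd bracket q d ^ (q ^ Suc i)"
        using dvd_bracket by (meson dvd_power_same dvd_trans le_imp_power_dvd)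
      ultimately show ?thesis by (metis cong_iff_dvd_diff dvd_minus_iff)
    qed
    have "(\<Prod>i<d. monom 1 1 - X (d + i)) = - bracket q d * (\<Prod>i<k. monom 1 1 - X (d + Suc i))"
      by (subst (1) d, subst prod.lessThan_Suc_shift) (simp add: bracket_def)
    moreover have "[(\<Prod>i<k. monom 1 1 - X (d + Suc i)) = (\<Prod>i<k. - bracket q (Suc i))] (mod P ^ q)"
      by (rule cong_prod) (rule step)
    moreover have "(\<Prod>i<k. - bracket q (Suc i)) = (-1) ^ k * L"
      by (simp add: prod_uminus carlitz_L_prod k_def)
    ultimately have "[(\<Prod>i<d. monom 1 1 - X (d + i)) = - bracket q d * ((-1) ^ k * L)] (mod P ^ q)"
      by (metis cong_scalar_left)
    then show ?thesis by (simp add: d mult.assoc mult.left_commute)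
  qed
  ultimately have "P ^ q dvd (P - (\<Prod>i<d. monom 1 1 - X (d + i)))
      + ((\<Prod>i<d. monom 1 1 - X (d + i)) - (-1) ^ d * bracket q d * L)"
    unfolding cong_iff_dvd_diff by (rule dvd_add)
  then show ?thesis by simp
qed

section \<open>The cofactor of \<open>P\<close> in \<open>bracket q d\<close> and its
  inverse\<close>

definition Q :: "'a poly" where "Q = bracket q d div P"

lemma bracket_eq: "bracket q d = P * Q"
  using dvd_bracket by (simp add: Q_def)

text \<open>Cancelling one factor \<open>P\<close> in \<open>power_q_dvd\<close> costs one in the
  exponent. Thus \<open>(-1) ^ d * L\<close> inverts \<open>Q\<close> modulo
  \<open>P ^ (q - 1)\<close>.\<close>

lemma Q_L_dvd: "P ^ (q - 1) dvd 1 - (-1) ^ d * Q * L"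
proof -
  have "P * P ^ (q - 1) = P ^ q" using q_gt_1 by (simp flip: power_Suc)
  moreover have "P - (-1) ^ d * bracket q d * L = P * (1 - (-1) ^ d * Q * L)"
    by (simp add: bracket_eq algebra_simps)
  moreover have "P \<noteq> 0" using irreducible_P by auto
  ultimately show ?thesis using power_q_dvd by (metis dvd_mult_cancel_left)
qed

text \<open>Both \<open>- f\<close> and \<open>(-1) ^ d * L\<close> invert \<open>Q\<close> modulo
  \<open>P ^ m\<close>, and inverses are unique.\<close>

lemma L_cong_of_Q_cong:
  assumes "m < q" and "P ^ m dvd f * Q + 1"
  shows "P ^ m dvd L - (-1) ^ (d - 1) * f"
proof -
  have d: "(-1) ^ d = - ((-1) ^ (d - 1) :: 'a poly)" using d_gt_1 by (cases d) auto
  have "P ^ m dvd P ^ (q - 1)" using assms(1) by (intro le_imp_power_dvd) auto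
  then have "P ^ m dvd 1 - (-1) ^ d * Q * L" using Q_L_dvd by (rule dvd_trans)
  then have "P ^ m dvd (f * Q + 1) * L - ((-1) ^ (d - 1) * f) * (1 - (-1) ^ d * Q * L)"
    by (rule dvd_diff[OF dvd_mult2[OF assms(2)] dvd_mult])
  moreover have "(f * Q + 1) * L - ((-1) ^ (d - 1) * f) * (1 - (-1) ^ d * Q * L)
      = L - (-1) ^ (d - 1) * f"
    using sign_mult_sign[of "d - 1" "f * Q * L"] by (simp add: d algebra_simps)
  ultimately show ?thesis by simp
qed

lemma L_cong_pderiv: "P dvd L - (-1) ^ (d - 1) * pderiv P"
proof -
  have "- 1 = P * pderiv Q + Q * pderiv P"
    using pderiv_bracket[of d] d_gt_1 by (simp add: bracket_eq pderiv_mult)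
  then have "P * pderiv Q + Q * pderiv P + 1 = 0" by (metis add.left_inverse)
  then have "pderiv P * Q + 1 = P * (- pderiv Q)"
    by (simp add: mult.commute eq_neg_iff_add_eq_0 add_ac)
  then show ?thesis using L_cong_of_Q_cong[of 1 "pderiv P"] q_gt_1 by simp
qed

section \<open>Criteria for divisibility by \<open>P\<close>\<close>

text \<open>The \<open>q\<close>-th power moves the factors of \<open>D\<close> to
  \<open>X d - X (Suc i)\<close>, and modulo \<open>P\<close> the term \<open>X d\<close> is the
  variable, which leaves negated brackets.\<close>

lemma carlitz_D_power_cong: "P dvd D ^ q - (-1) ^ (d - 1) * L"
proof -
  have "D ^ q = (\<Prod>i<d - 1. X d - X (Suc i))"
  proof -
    have "(X (d - 1) - X i) ^ q = X d - X (Suc i)" for i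
    proof -
      have "q ^ (d - 1) * q = q ^ d" using d_gt_1 by (simp flip: power_Suc2)
      moreover have "(X (d - 1) - X i) ^ q = X (d - 1) ^ q - X i ^ q"
        using power_q_diff[of "X (d - 1)" "X i" 1] by simp
      ultimately show ?thesis by (simp only: monom_power power_Suc2 power_one)
    qed
    then show ?thesis by (simp add: carlitz_D_prod prod_power_distrib)
  qed
  moreover have "[(\<Prod>i<d - 1. X d - X (Suc i)) = (\<Prod>i<d - 1. - bracket q (Suc i))] (mod P)"
  proof (rule cong_prod)
    fix i
    have "X d - X (Suc i) - (- bracket q (Suc i)) = bracket q d" by (simp add: bracket_def)
    then show "[X d - X (Suc i) = - bracket q (Suc i)] (mod P)"
      using dvd_bracket by (simp only: cong_iff_dvd_diff)
  qed
  moreover have "(\<Prod>i<d - 1. - bracket q (Suc i)) = (-1) ^ (d - 1) * L"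
    by (simp add: prod_uminus carlitz_L_prod)
  ultimately show ?thesis by (simp add: cong_iff_dvd_diff)
qed

text \<open>By \<open>L_cong_pderiv\<close> the question is whether \<open>pderiv P\<close> is
  congruent to a constant. Both have degree below \<open>d\<close>, so congruence is
  equality.\<close>

lemma dvd_carlitz_L_iff_pderiv:
  "P dvd L - [:c:] \<longleftrightarrow> pderiv P = [:(-1) ^ (d - 1) * c:]"
proof -
  have sign: "(-1) ^ (d - 1) * [:(-1) ^ (d - 1) * c:] = [:c:]"
    by (simp only: const_sign_mult sign_mult_sign)
  let ?g = "pderiv P - [:(-1) ^ (d - 1) * c:]"
  have "P dvd L - [:c:] \<longleftrightarrow> P dvd (L - [:c:]) - (L - (-1) ^ (d - 1) * pderiv P)"
    using L_cong_pderiv by (metis dvd_diff diff_add_cancel dvd_add)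
  also have "(L - [:c:]) - (L - (-1) ^ (d - 1) * pderiv P) = (-1) ^ (d - 1) * ?g"
    using sign by (simp add: right_diff_distrib)
  also have "P dvd \<dots> \<longleftrightarrow> P dvd ?g" by (rule dvd_sign_mult_iff)
  also have "\<dots> \<longleftrightarrow> ?g = 0"
  proof
    have "\<forall>n\<ge>d. coeff ?g n = 0"
      using degree_P d_gt_1 by (auto simp: coeff_pderiv coeff_eq_0 coeff_pCons split: nat.splits)
    then show "P dvd ?g \<Longrightarrow> ?g = 0" using not_dvd_small by blast
  qed simp
  finally show ?thesis by simp
qed

text \<open>Since \<open>P\<close> is prime, the left side may be raised to the power
  \<open>q\<close>, which fixes the constant and replaces \<open>D\<close> by
  \<open>D ^ q\<close>.\<close>

lemma dvd_carlitz_D_iff_dvd_carlitz_L: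
  "P dvd D + [:(-1) ^ d * c:] \<longleftrightarrow> P dvd L - [:c:]"
proof -
  have sign: "[:(-1) ^ d * c:] = - ((-1) ^ (d - 1) * [:c:])"
    using d_gt_1 unfolding const_sign_mult by (cases d) simp_all
  have "P dvd D + [:(-1) ^ d * c:] \<longleftrightarrow> P dvd (D + [:(-1) ^ d * c:]) ^ q"
    using q_gt_1 by (simp add: prime_elem_dvd_power_iff[OF prime_P])
  also have "(D + [:(-1) ^ d * c:]) ^ q = D ^ q + [:(-1) ^ d * c:]"
    using power_q_add[of D "[:(-1) ^ d * c:]" 1] const_power_q[of "(-1) ^ d * c" 1]
    by (simp add: poly_const_pow)
  also have "\<dots> = (D ^ q - (-1) ^ (d - 1) * L) + (-1) ^ (d - 1) * (L - [:c:])"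
    unfolding sign by (simp add: right_diff_distrib)
  also have "P dvd \<dots> \<longleftrightarrow> P dvd L - [:c:]"
    using carlitz_D_power_cong by (simp add: dvd_add_right_iff dvd_sign_mult_iff)
  finally show ?thesis .
qed

section \<open>Multiplicities and the degree condition\<close>

text \<open>By \<open>fermat'\<close>, \<open>P\<close> divides \<open>a ^ (q ^ d) - a\<close>, so
  its \<open>p\<close>-th power is divisible by \<open>P ^ p\<close>. Dividing the identity for
  \<open>[:s:] * bracket q d\<close> by \<open>P\<close> leaves the exponent
  \<open>p - 1\<close>.\<close>

lemma power_dvd_carlitz_L:
  assumes "P = a ^ p + monom ((-1) ^ (d - 1) * c) 1"
  shows "P ^ (p - 1) dvd L - [:c:]"
proof -
  define s where "s = (-1) ^ (d - 1) * c"
  have p: "p > 0" using prime_gt_0_nat[OF prime_p] .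
  have P: "monom s 1 = P - a ^ p" using assms(1) by (simp add: s_def)
  have "[:s:] * X d = monom s 1 ^ (q ^ d)"
    by (simp add: monom_power const_power_q smult_monom)
  also have "\<dots> = P ^ (q ^ d) - (a ^ (q ^ d)) ^ p"
    unfolding P by (simp add: power_q_diff power_mult[symmetric] mult.commute)
  finally have "[:s:] * bracket q d = P ^ (q ^ d) - P - (a ^ (q ^ d) - a) ^ p"
    using P by (simp add: bracket_def right_diff_distrib power_p_diff smult_monom)
  then have "P * ([:s:] * Q + 1) = P ^ (q ^ d) - (a ^ (q ^ d) - a) ^ p"
    by (simp add: bracket_eq algebra_simps)
  moreover have "p \<le> q ^ d"
    using p_le_q self_le_power[of q d] q_gt_1 d_gt_1 by simp
  then have "P ^ p dvd P ^ (q ^ d) - (a ^ (q ^ d) - a) ^ p"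
    by (intro dvd_diff le_imp_power_dvd dvd_power_same fermat')
  moreover have "P ^ p = P * P ^ (p - 1)" using p by (simp flip: power_Suc)
  moreover have "P \<noteq> 0" using irreducible_P by auto
  ultimately have "P ^ (p - 1) dvd [:s:] * Q + 1" by (metis dvd_mult_cancel_left)
  then have "P ^ (p - 1) dvd L - (-1) ^ (d - 1) * [:s:]"
    using p p_le_q by (intro L_cong_of_Q_cong) auto
  moreover have "(-1) ^ (d - 1) * [:s:] = [:c:]"
    by (simp only: s_def const_sign_mult sign_mult_sign)
  ultimately show ?thesis by simp
qed

text \<open>In the recursion for \<open>D\<close> the \<open>q\<close>-th power has derivative 0, so
  only the derivative \<open>- 1\<close> of the bracket contributes.\<close>

lemma not_dvd_pderiv_carlitz_D: "\<not> P dvd pderiv (D + [:u:])"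
proof -
  define k where "k = d - 2"
  have k: "d - 1 = Suc k" using d_gt_1 by (simp add: k_def)
  have "of_nat q = (0::'a)" using e_pos by (simp add: of_nat_eq_0_iff_char_dvd CHAR_eq q_eq)
  then have "pderiv (D + [:u:]) = - (carlitz_D q k ^ q)"
    using pderiv_bracket[of "Suc k"] unfolding k by (simp add: pderiv_add pderiv_mult pderiv_power)
  moreover have "\<not> P dvd (\<Prod>i<k. X k - X i)"
  proof
    assume "P dvd (\<Prod>i<k. X k - X i)"
    then obtain i where i: "i < k" "P dvd X k - X i"
      using prime_elem_dvd_prodD[OF prime_P] by (metis lessThan_iff)
    then show False using not_dvd_X_diff[of i k] k by simp
  qed
  ultimately show ?thesis using prime_elem_dvd_power[OF prime_P] by (auto simp: carlitz_D_prod)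
qed

text \<open>Ensures that \<open>L - [:c:]\<close> is nonzero, as \<open>poly_multiplicity_ge\<close>
  requires. The factor \<open>bracket q (d - 1)\<close> of \<open>L\<close> has positive degree
  because \<open>d > 1\<close>.\<close>

lemma carlitz_L_neq_const: "L \<noteq> [:c:]"
proof
  assume *: "L = [:c:]"
  have deg: "degree (bracket q (Suc i) :: 'a poly) = q ^ Suc i" for i
    using lead_coeff_bracket(1)[where 'a = 'a] q_gt_1 by simp
  then have nz: "bracket q (Suc i) \<noteq> (0 :: 'a poly)" for i
    using q_gt_1 by (metis degree_0 not_one_less_zero power_eq_0_iff)
  define k where "k = d - 2"
  have k: "d - 1 = Suc k" using d_gt_1 by (simp add: k_def)
  have "(bracket q (Suc k) :: 'a poly) dvd [:c:]" using * by (metis k carlitz_L.simps(2) dvd_triv_left)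
  moreover have "[:c:] \<noteq> 0" using * nz by (metis carlitz_L_prod prod_zero_iff finite_lessThan)
  ultimately have "degree (bracket q (Suc k) :: 'a poly) \<le> 0"
    by (metis degree_pCons_0 dvd_imp_degree_le)
  then show False using deg q_gt_1 by (metis le_zero_eq not_one_less_zero power_eq_0_iff)
qed

text \<open>As \<open>P\<close> is monic, its derivative has coefficient \<open>d\<close> at
  exponent \<open>d - 1 > 0\<close>, which must vanish if the derivative is constant.\<close>

lemma char_dvd_degree:
  assumes "pderiv P = [:s:]"
  shows "p dvd d"
proof -
  have "coeff (pderiv P) (d - 1) = 0" using d_gt_1 assms by (simp add: coeff_pCons split: nat.split)
  then have "of_nat d = (0::'a)" using monic_P degree_P d_gt_1 by (simp add: coeff_pderiv)
  then show ?thesis by (simp add: of_nat_eq_0_iff_char_dvd CHAR_eq)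
qed

end

theorem theorem7:
  fixes p e q d :: nat and c :: "'a::{field,finite}"
  assumes "prime p" and "e \<ge> 1" and "q = p ^ e" and "card (UNIV :: 'a set) = q"
    and "d > 1" and "c \<noteq> 0"
  shows
    "{P \<in> monic_primes d. P dvd carlitz_L q (d - 1) - [:c:]}
       = {P \<in> monic_primes d. P dvd carlitz_D q (d - 1) + [:(-1) ^ d * c:]}
     \<and> {P \<in> monic_primes d. P dvd carlitz_L q (d - 1) - [:c:]}
       = {P \<in> monic_primes d. pderiv P = [:(-1) ^ (d - 1) * c:]}
     \<and> {P \<in> monic_primes d. pderiv P = [:(-1) ^ (d - 1) * c:]}
       = {P \<in> monic_primes d. \<exists>a. P = a ^ p + monom ((-1) ^ (d - 1) * c) 1}
     \<and> ({P \<in> monic_primes d. P dvd carlitz_L q (d - 1) - [:c:]} \<noteq> {} \<longrightarrow> p dvd d)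
     \<and> (\<forall>P \<in> monic_primes d. P dvd carlitz_L q (d - 1) - [:c:] \<longrightarrow>
          poly_multiplicity P (carlitz_L q (d - 1) - [:c:]) \<ge> p - 1
          \<and> poly_multiplicity P (carlitz_D q (d - 1) + [:(-1) ^ d * c:]) = 1)"
proof -
  interpret finite_field_polys p e q "TYPE('a)"
    using assms by unfold_locales auto
  have loc: "prime_poly p e q P d" if "P \<in> monic_primes d" for P :: "'a poly"
    using that assms(5) by unfold_locales (auto simp: monic_primes_def)
  note L_iff = prime_poly.dvd_carlitz_L_iff_pderiv[OF loc]
    and D_iff = prime_poly.dvd_carlitz_D_iff_dvd_carlitz_L[OF loc]
  have mult: "poly_multiplicity P (carlitz_L q (d - 1) - [:c:]) \<ge> p - 1
      \<and> poly_multiplicity P (carlitz_D q (d - 1) + [:(-1) ^ d * c:]) = 1"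
    if P: "P \<in> monic_primes d" and dvd: "P dvd carlitz_L q (d - 1) - [:c:]" for P
  proof
    obtain a where "P = a ^ p + monom ((-1) ^ (d - 1) * c) 1"
      using dvd L_iff[OF P] pderiv_eq_const_iff by blast
    then have "P ^ (p - 1) dvd carlitz_L q (d - 1) - [:c:]"
      by (rule prime_poly.power_dvd_carlitz_L[OF loc[OF P]])
    then show "poly_multiplicity P (carlitz_L q (d - 1) - [:c:]) \<ge> p - 1"
      using prime_poly.carlitz_L_neq_const[OF loc[OF P]] prime_poly.irreducible_P[OF loc[OF P]]
      by (intro poly_multiplicity_ge) auto
    show "poly_multiplicity P (carlitz_D q (d - 1) + [:(-1) ^ d * c:]) = 1"
      using dvd D_iff[OF P] prime_poly.not_dvd_pderiv_carlitz_D[OF loc[OF P]]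
      by (intro poly_multiplicity_eq_1) auto
  qed
  show ?thesis
    using L_iff D_iff pderiv_eq_const_iff prime_poly.char_dvd_degree[OF loc] mult
    by (intro conjI) (auto, blast+)
qed

end
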